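(* Let $K$ be any field of characteristic $\neq 2$. There exists a 12-dimensional 7-nilpotent Lie algebra over $K$ whose reduced Koszul map $\bar\eta:H_3(\mathfrak{g})\to\mathrm{Kill}(\mathfrak{g})$ is nonzero.
   Context: The lower central series is $\mathfrak{g}^{(1)}=\mathfrak{g}$, $\mathfrak{g}^{(i+1)}=[\mathfrak{g},\mathfrak{g}^{(i)}]$; $\mathfrak{g}$ is $k$-nilpotent if $\mathfrak{g}^{(k+1)}=\{0\}$. Tensor, exterior and symmetric powers are over $K$. $H_*(\mathfrak{g})$ is the homology of the Chevalley–Eilenberg complex $\Lambda^*\mathfrak{g}$ with $\partial_n(x_1\wedge\dots\wedge x_n)=\sum_{i<j}(-1)^{i+j}[x_i,x_j]\wedge x_1\wedge\dots\wedge\hat{x_i}\wedge\dots\wedge\hat{x_j}\wedge\dots\wedge x_n$, and $Z_3(\mathfrak{g})=\ker\partial_3$. Writing $x\odot y$ for the product in the symmetric square $S^2\mathfrak{g}$, the Killing module $\mathrm{Kill}(\mathfrak{g})$ is the cokernel of $\mathfrak{g}^{\otimes 3}\to S^2\mathfrak{g}$, $x\otimes y\otimes z\mapsto [x,y]\odot z-x\odot[y,z]$. The Koszul map $\eta:\Lambda^3\mathfrak{g}\to\mathrm{Kill}(\mathfrak{g})$ sends $x\wedge y\wedge z$ to the class of $x\odot[y,z]$; it vanishes on 3-boundaries, and the reduced Koszul map $\bar\eta:H_3(\mathfrak{g})\to\mathrm{Kill}(\mathfrak{g})$ is induced by restricting $\eta$ to $Z_3(\mathfrak{g})$. *)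

theory Defs
  imports "HOL-Analysis.Analysis" "HOL-Library.Poly_Mapping" "HOL-Library.Set_Algebras"
begin

section \<open>Free vector spaces and quotients\<close>

text \<open>The type \<open>'b \<Rightarrow>\<^sub>0 'k\<close> is the free vector space on \<open>'b\<close>; \<open>basis b\<close> is the
  generator attached to \<open>b\<close> and \<open>lin_extend\<close> the linear extension of a map given on generators.\<close>

definition fscale :: "'k::field \<Rightarrow> ('b \<Rightarrow>\<^sub>0 'k) \<Rightarrow> ('b \<Rightarrow>\<^sub>0 'k)"
  where "fscale c p = Poly_Mapping.map ((*) c) p"

definition basis :: "'b \<Rightarrow> ('b \<Rightarrow>\<^sub>0 'k::field)"
  where "basis b = Poly_Mapping.single b 1"

lemma lookup_fscale [simp]: "Poly_Mapping.lookup (fscale c p) b = c * Poly_Mapping.lookup p b"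
  by (simp add: fscale_def Poly_Mapping.map.rep_eq when_def)

interpretation free: vector_space fscale
  by unfold_locales (auto intro!: poly_mapping_eqI simp: lookup_add algebra_simps)

definition lin_extend :: "('b \<Rightarrow> ('c \<Rightarrow>\<^sub>0 'k)) \<Rightarrow> ('b \<Rightarrow>\<^sub>0 'k::field) \<Rightarrow> ('c \<Rightarrow>\<^sub>0 'k)"
  where "lin_extend f p = (\<Sum>b\<in>Poly_Mapping.keys p. fscale (Poly_Mapping.lookup p b) (f b))"

text \<open>\<open>quot V W\<close> is \<open>V / W\<close>, the set of all cosets \<open>v + W\<close>; its zero element is \<open>W\<close>.  Addition of
  cosets is the elementwise addition of sets, so \<open>quot\<close> also applies when \<open>V\<close> and \<open>W\<close> are
  themselves sets of cosets.  A map \<open>f\<close> on \<open>V\<close> that is constant on cosets induces the map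
  \<open>induced f\<close> on the quotient, sending a coset to the common value of \<open>f\<close> on its members.\<close>

definition quot :: "'v::plus set \<Rightarrow> 'v set \<Rightarrow> 'v set set"
  where "quot V W = (\<lambda>v. v +o W) ` V"

definition induced :: "('v \<Rightarrow> 'w) \<Rightarrow> 'v set \<Rightarrow> 'w"
  where "induced f X = the_elem (f ` X)"


section \<open>Tensor, exterior and symmetric powers\<close>

text \<open>All three are quotients of \<open>words n\<close>, the free vector space on the set of \<open>n\<close>-tuples; the
  basis element of \<open>[x\<^sub>1, \<dots>, x\<^sub>n]\<close> represents \<open>x\<^sub>1 \<otimes> \<dots> \<otimes> x\<^sub>n\<close>, \<open>x\<^sub>1 \<and> \<dots> \<and> x\<^sub>n\<close> and
  (for \<open>n = 2\<close>) \<open>x\<^sub>1 \<odot> x\<^sub>2\<close> respectively.\<close>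

definition words :: "nat \<Rightarrow> ('a list \<Rightarrow>\<^sub>0 'k::field) set"
  where "words n = {p. \<forall>xs\<in>Poly_Mapping.keys p. length xs = n}"

definition multilinear_relators :: "('k::field \<Rightarrow> 'a::ab_group_add \<Rightarrow> 'a) \<Rightarrow> nat \<Rightarrow> ('a list \<Rightarrow>\<^sub>0 'k) set"
  where "multilinear_relators s n =
    {basis (us @ (x + y) # vs) - basis (us @ x # vs) - basis (us @ y # vs) | us x y vs.
        length (us @ x # vs) = n} \<union>
    {basis (us @ s c x # vs) - fscale c (basis (us @ x # vs)) | us c x vs.
        length (us @ x # vs) = n}"

definition tensor_null :: "('k::field \<Rightarrow> 'a::ab_group_add \<Rightarrow> 'a) \<Rightarrow> nat \<Rightarrow> ('a list \<Rightarrow>\<^sub>0 'k) set"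
  where "tensor_null s n = free.span (multilinear_relators s n)"

definition ext_null :: "('k::field \<Rightarrow> 'a::ab_group_add \<Rightarrow> 'a) \<Rightarrow> nat \<Rightarrow> ('a list \<Rightarrow>\<^sub>0 'k) set"
  where "ext_null s n = free.span (multilinear_relators s n \<union>
    {basis xs | xs. length xs = n \<and> \<not> distinct xs})"

definition sym2_null :: "('k::field \<Rightarrow> 'a::ab_group_add \<Rightarrow> 'a) \<Rightarrow> ('a list \<Rightarrow>\<^sub>0 'k) set"
  where "sym2_null s = free.span (multilinear_relators s 2 \<union>
    {basis [x, y] - basis [y, x] | x y. True})"

definition tensor_power :: "('k::field \<Rightarrow> 'a::ab_group_add \<Rightarrow> 'a) \<Rightarrow> nat \<Rightarrow> ('a list \<Rightarrow>\<^sub>0 'k) set set"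
  where "tensor_power s n = quot (words n) (tensor_null s n)"

definition ext_power :: "('k::field \<Rightarrow> 'a::ab_group_add \<Rightarrow> 'a) \<Rightarrow> nat \<Rightarrow> ('a list \<Rightarrow>\<^sub>0 'k) set set"
  where "ext_power s n = quot (words n) (ext_null s n)"

definition sym2 :: "('k::field \<Rightarrow> 'a::ab_group_add \<Rightarrow> 'a) \<Rightarrow> ('a list \<Rightarrow>\<^sub>0 'k) set set"
  where "sym2 s = quot (words 2) (sym2_null s)"


section \<open>Lie algebras\<close>

locale lie_algebra = vector_space scale
  for scale :: "'k::field \<Rightarrow> 'a::ab_group_add \<Rightarrow> 'a" +
  fixes bracket :: "'a \<Rightarrow> 'a \<Rightarrow> 'a"
  assumes linear_left: "Vector_Spaces.linear scale scale (\<lambda>x. bracket x y)"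
    and linear_right: "Vector_Spaces.linear scale scale (\<lambda>y. bracket x y)"
    and alternating: "bracket x x = 0"
    and jacobi: "bracket x (bracket y z) + bracket y (bracket z x) + bracket z (bracket x y) = 0"
begin

text \<open>Indexed from \<open>1\<close>; the value at \<open>0\<close> is a dummy.\<close>

fun lower_central :: "nat \<Rightarrow> 'a set" where
  "lower_central 0 = UNIV"
| "lower_central (Suc 0) = UNIV"
| "lower_central (Suc (Suc i)) = span {bracket x y | x y. y \<in> lower_central (Suc i)}"

definition nilpotent :: "nat \<Rightarrow> bool"
  where "nilpotent k \<longleftrightarrow> lower_central (k + 1) = {0}"


subsection \<open>Chevalley--Eilenberg homology\<close>

text \<open>Positions are counted from \<open>0\<close> here, which does not affect the sign \<open>(-1)\<^sup>i\<^sup>+\<^sup>j\<close>.\<close>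

definition boundary_word :: "'a list \<Rightarrow> ('a list \<Rightarrow>\<^sub>0 'k)"
  where "boundary_word xs = (\<Sum>(i, j)\<in>{(i, j). i < j \<and> j < length xs}.
    fscale ((-1) ^ (i + j)) (basis (bracket (xs ! i) (xs ! j) # nths xs (- {i, j}))))"

definition boundary :: "nat \<Rightarrow> ('a list \<Rightarrow>\<^sub>0 'k) set \<Rightarrow> ('a list \<Rightarrow>\<^sub>0 'k) set"
  where "boundary n = induced (\<lambda>p. lin_extend boundary_word p +o ext_null scale (n - 1))"

definition cycles :: "nat \<Rightarrow> ('a list \<Rightarrow>\<^sub>0 'k) set set"
  where "cycles n = {w \<in> ext_power scale n. boundary n w = ext_null scale (n - 1)}"

definition boundaries :: "nat \<Rightarrow> ('a list \<Rightarrow>\<^sub>0 'k) set set"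
  where "boundaries n = boundary (n + 1) ` ext_power scale (n + 1)"

definition homology :: "nat \<Rightarrow> ('a list \<Rightarrow>\<^sub>0 'k) set set set"
  where "homology n = quot (cycles n) (boundaries n)"


subsection \<open>Killing module and Koszul map\<close>

text \<open>The map \<open>x \<otimes> y \<otimes> z \<mapsto> [x,y] \<odot> z - x \<odot> [y,z]\<close> from the tensor cube to the symmetric
  square.\<close>

definition killing_word :: "'a list \<Rightarrow> ('a list \<Rightarrow>\<^sub>0 'k)"
  where "killing_word xs = (case xs of
      [x, y, z] \<Rightarrow> basis [bracket x y, z] - basis [x, bracket y z]
    | _ \<Rightarrow> 0)"

definition killing_map :: "('a list \<Rightarrow>\<^sub>0 'k) set \<Rightarrow> ('a list \<Rightarrow>\<^sub>0 'k) set"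
  where "killing_map = induced (\<lambda>p. lin_extend killing_word p +o sym2_null scale)"

definition killing_null :: "('a list \<Rightarrow>\<^sub>0 'k) set set"
  where "killing_null = killing_map ` tensor_power scale 3"

definition killing_module :: "('a list \<Rightarrow>\<^sub>0 'k) set set set"
  where "killing_module = quot (sym2 scale) killing_null"

definition koszul_word :: "'a list \<Rightarrow> ('a list \<Rightarrow>\<^sub>0 'k)"
  where "koszul_word xs = (case xs of
      [x, y, z] \<Rightarrow> basis [x, bracket y z]
    | _ \<Rightarrow> 0)"

definition koszul_map :: "('a list \<Rightarrow>\<^sub>0 'k) set \<Rightarrow> ('a list \<Rightarrow>\<^sub>0 'k) set set"
  where "koszul_map = induced (\<lambda>p. (lin_extend koszul_word p +o sym2_null scale) +o killing_null)"

text \<open>The elements of \<open>homology 3\<close> are cosets, in the space of 3-cycles, of the space of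
  3-boundaries, on which \<open>koszul_map\<close> vanishes.  The zero element of the Killing module is
  \<open>killing_null\<close>.\<close>

definition reduced_koszul_map :: "('a list \<Rightarrow>\<^sub>0 'k) set set \<Rightarrow> ('a list \<Rightarrow>\<^sub>0 'k) set set"
  where "reduced_koszul_map = induced koszul_map"

end

end

theory Submission
  imports Defs
begin

text \<open>
  Let \<open>B\<close> be an invariant symmetric bilinear form.  It factors through the Killing module, so
  the Koszul map is nonzero on the class of any 3-cycle \<open>w\<close> on which the Cartan 3-form
  \<open>B(x, [y, z])\<close> does not vanish.  A suitable algebra is a \<open>T\<^sup>*\<close>-extension \<open>\<aa> \<oplus> \<aa>\<^sup>*\<close>
  by a closed 3-form \<open>\<theta>\<close>, with \<open>B\<close> the natural pairing.  Here \<open>\<aa>\<close> is the 6-dimensional algebra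
  \<open>[e\<^sub>0, e\<^sub>1] = e\<^sub>2\<close>, \<open>[e\<^sub>0, e\<^sub>2] = e\<^sub>3\<close>, \<open>[e\<^sub>1, e\<^sub>2] = e\<^sub>4\<close>, \<open>[e\<^sub>0, e\<^sub>3] = e\<^sub>5 = - [e\<^sub>1, e\<^sub>4]\<close>,
  graded with weights \<open>1, 1, 2, 3, 3, 4\<close>, and
  \<open>\<theta> = e\<^sup>0\<^sup>2\<^sup>4 + e\<^sup>0\<^sup>3\<^sup>5 + e\<^sup>1\<^sup>4\<^sup>5\<close> has components of the two weights \<open>6\<close> and \<open>8\<close>.  Were \<open>\<theta>\<close>
  homogeneous of weight \<open>d\<close>, the derivation acting by \<open>i / d\<close> on the part of weight \<open>i\<close> of \<open>\<aa>\<close> and by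
  \<open>1 - i / d\<close> on its dual would make the Cartan 3-form exact; two weights that differ by \<open>2\<close> rule
  out such a derivation unless the characteristic is \<open>2\<close>.
\<close>

section \<open>Linear maps on free vector spaces\<close>

abbreviation flinear :: "(('b \<Rightarrow>\<^sub>0 'k::field) \<Rightarrow> ('c \<Rightarrow>\<^sub>0 'k)) \<Rightarrow> bool"
  where "flinear \<equiv> Vector_Spaces.linear fscale fscale"

lemma fscale_minus_one: "fscale (- 1) p = - p"
  by (simp add: free.scale_minus_left)

lemma fscale_single: "fscale c (Poly_Mapping.single b d) = Poly_Mapping.single b (c * d)"
  by (rule poly_mapping_eqI) (simp add: lookup_single when_def)

lemma flinearI:
  assumes "\<And>p q. f (p + q) = f p + f q" "\<And>c p. f (fscale c p) = fscale c (f p)"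
  shows "flinear f"
  by (simp add: Vector_Spaces.linear_iff free.vector_space_axioms assms)

lemma
  assumes "flinear f"
  shows flinear_add: "f (p + q) = f p + f q"
    and flinear_scale: "f (fscale c p) = fscale c (f p)"
    and flinear_zero: "f 0 = 0"
    and flinear_minus: "f (- p) = - f p"
    and flinear_diff: "f (p - q) = f p - f q"
proof -
  interpret Vector_Spaces.linear fscale fscale f by fact
  show "f (p + q) = f p + f q" "f (fscale c p) = fscale c (f p)" "f 0 = 0" "f (- p) = - f p"
    "f (p - q) = f p - f q"
    by (rule add scale zero neg diff)+
qed

lemmas flinear_simps = flinear_add flinear_scale flinear_zero flinear_minus flinear_diff

lemma flinear_sum:
  assumes "flinear f"
  shows "f (sum g A) = (\<Sum>x\<in>A. f (g x))"
  by (induction A rule: infinite_finite_induct) (simp_all add: flinear_simps[OF assms])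

lemma flinear_comp: "flinear f \<Longrightarrow> flinear g \<Longrightarrow> flinear (\<lambda>p. g (f p))"
  by (rule flinearI) (simp_all add: flinear_simps)

text \<open>A larger finite index set lets \<open>p\<close>, \<open>q\<close> and
  \<open>p + q\<close> be summed over one common set, which is how additivity of
  \<open>lin_extend\<close> is obtained.\<close>

lemma lin_extend_superset:
  assumes "finite A" "Poly_Mapping.keys p \<subseteq> A"
  shows "lin_extend f p = (\<Sum>b\<in>A. fscale (Poly_Mapping.lookup p b) (f b))"
  unfolding lin_extend_def using assms
  by (intro sum.mono_neutral_left) (auto simp: in_keys_iff)

lemma flinear_lin_extend [simp]:
  fixes f :: "'b \<Rightarrow> ('c \<Rightarrow>\<^sub>0 'k::field)"
  shows "flinear (lin_extend f)"
proof (rule flinearI)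
  fix p q :: "'b \<Rightarrow>\<^sub>0 'k"
  let ?A = "Poly_Mapping.keys p \<union> Poly_Mapping.keys q"
  have "lin_extend f r = (\<Sum>b\<in>?A. fscale (Poly_Mapping.lookup r b) (f b))"
    if "r \<in> {p, q, p + q}" for r
    using that Poly_Mapping.keys_add[of p q] by (intro lin_extend_superset) auto
  then show "lin_extend f (p + q) = lin_extend f p + lin_extend f q"
    by (simp add: lookup_add free.scale_left_distrib sum.distrib)
next
  fix c and p :: "'b \<Rightarrow>\<^sub>0 'k"
  have "lin_extend f (fscale c p)
      = (\<Sum>b\<in>Poly_Mapping.keys p. fscale (Poly_Mapping.lookup (fscale c p) b) (f b))"
    by (intro lin_extend_superset) (auto simp: in_keys_iff)
  then show "lin_extend f (fscale c p) = fscale c (lin_extend f p)"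
    by (simp add: lin_extend_def free.scale_sum_right)
qed

lemmas lin_extend_simps = flinear_simps[OF flinear_lin_extend]

lemma lin_extend_basis [simp]: "lin_extend f (basis b) = f b"
  by (simp add: lin_extend_def basis_def)

lemma lookup_basis: "Poly_Mapping.lookup (basis b) c = (if b = c then 1 else 0)"
  by (simp add: basis_def lookup_single)

lemma lin_extend_basis_id: "lin_extend basis p = p"
proof (rule poly_mapping_eqI)
  fix b
  have "Poly_Mapping.lookup (lin_extend basis p) b
      = (\<Sum>c\<in>Poly_Mapping.keys p. if c = b then Poly_Mapping.lookup p c else 0)"
    unfolding lin_extend_def lookup_sum by (intro sum.cong) (auto simp: lookup_basis)
  also have "\<dots> = Poly_Mapping.lookup p b"
    by (simp add: in_keys_iff)
  finally show "Poly_Mapping.lookup (lin_extend basis p) b = Poly_Mapping.lookup p b" .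
qed

lemma zero_on_span_iff:
  assumes "flinear f"
  shows "(\<forall>p \<in> free.span S. f p = 0) \<longleftrightarrow> (\<forall>p \<in> S. f p = 0)"
proof
  assume *: "\<forall>p \<in> S. f p = 0"
  show "\<forall>p \<in> free.span S. f p = 0"
  proof
    fix p assume "p \<in> free.span S"
    then show "f p = 0"
      by (induction rule: free.span_induct_alt) (auto simp: flinear_simps[OF assms] *)
  qed
qed (auto intro: free.span_base)

text \<open>Turns congruences modulo \<open>N\<close> into equations between values of \<open>f\<close>.\<close>

lemma subspace_kernel_of_flinear:
  fixes N :: "('b \<Rightarrow>\<^sub>0 'k::field) set"
  assumes "free.subspace N"
  obtains f :: "('b \<Rightarrow>\<^sub>0 'k) \<Rightarrow> ('b \<Rightarrow>\<^sub>0 'k)" where "flinear f" "\<And>p. f p = 0 \<longleftrightarrow> p \<in> N"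
proof -
  have id: "flinear (\<lambda>p :: 'b \<Rightarrow>\<^sub>0 'k. p)"
    by (rule flinearI) simp_all
  have "vector_space_pair (fscale :: 'k \<Rightarrow> ('b \<Rightarrow>\<^sub>0 'k) \<Rightarrow> _) (fscale :: 'k \<Rightarrow> ('b \<Rightarrow>\<^sub>0 'k) \<Rightarrow> _)"
    by (intro vector_space_pair.intro free.vector_space_axioms)
  from vector_space_pair.linear_exists_left_inverse_on[OF this id assms]
  obtain g :: "('b \<Rightarrow>\<^sub>0 'k) \<Rightarrow> ('b \<Rightarrow>\<^sub>0 'k)"
    where g: "range g \<subseteq> N" "flinear g" "\<And>p. p \<in> N \<Longrightarrow> g p = p"
    by (auto simp: inj_on_def)
  have "flinear (\<lambda>p. p - g p)"
    by (rule flinearI) (simp_all add: flinear_simps[OF g(2)] free.scale_right_diff_distrib)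
  moreover have "p - g p = 0 \<longleftrightarrow> p \<in> N" for p
    using g(1) g(3)[of p] by (metis eq_iff_diff_eq_0 rangeI subsetD)
  ultimately show thesis by (rule that)
qed

text \<open>With \<open>zero_on_span_iff\<close>, this reduces a linear identity on
  \<open>words n\<close> to single basis words.\<close>

lemma words_eq_span: "(words n :: ('a list \<Rightarrow>\<^sub>0 'b::field) set) = free.span (basis ` {xs. length xs = n})"
  (is "?W = ?S")
proof
  show "?W \<subseteq> ?S"
  proof
    fix p assume "p \<in> ?W"
    then have "lin_extend basis p \<in> ?S"
      unfolding lin_extend_def words_def
      by (intro free.span_sum free.span_scale free.span_base) auto
    then show "p \<in> ?S"
      by (simp add: lin_extend_basis_id)
  qed
  have "free.subspace ?W"
    unfolding free.subspace_def words_def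
    using Poly_Mapping.keys_add by (fastforce simp: in_keys_iff)
  moreover have "basis ` {xs. length xs = n} \<subseteq> ?W"
    by (auto simp: words_def basis_def)
  ultimately show "?S \<subseteq> ?W"
    by (intro free.span_minimal)
qed

lemma subspace_words [simp]: "free.subspace (words n)"
  by (simp add: words_eq_span)

lemma basis_in_words: "length xs = n \<Longrightarrow> basis xs \<in> words n"
  by (auto simp: words_eq_span intro: free.span_base)

section \<open>Cosets\<close>

lemma coset_eq_iff:
  assumes "free.subspace N"
  shows "p +o N = q +o N \<longleftrightarrow> p - q \<in> N"
proof
  assume "p +o N = q +o N"
  then have "p + 0 \<in> q +o N"
    using free.subspace_0[OF assms] by (metis set_plus_intro2)
  then show "p - q \<in> N"
    by (auto simp: elt_set_plus_def)
next
  have *: "p +o N \<subseteq> q +o N" if "p - q \<in> N" for p q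
  proof
    fix r assume "r \<in> p +o N"
    then obtain n where "n \<in> N" "r = p + n" by (auto simp: elt_set_plus_def)
    then have "r = q + ((p - q) + n)" "(p - q) + n \<in> N"
      using that free.subspace_add[OF assms] by auto
    then show "r \<in> q +o N" by (metis set_plus_intro2)
  qed
  assume "p - q \<in> N"
  moreover from this have "q - p \<in> N"
    using free.subspace_neg[OF assms] by fastforce
  ultimately show "p +o N = q +o N"
    using * by blast
qed

lemma coset_eq_self_iff: "free.subspace N \<Longrightarrow> p +o N = N \<longleftrightarrow> p \<in> N"
  using coset_eq_iff[of N p 0] by simp

lemma coset_plus_coset:
  assumes "free.subspace N"
  shows "(p +o N) + (q +o N) = (p + q) +o N"
proof -
  have "N + N = N"
    using free.subspace_add[OF assms] free.subspace_0[OF assms]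
    by (force simp: set_plus_def)
  then show ?thesis
    by (simp add: set_plus_rearrange)
qed

section \<open>Maps induced on quotients\<close>

lemma induced_eq:
  assumes "X \<noteq> {}" "\<And>x. x \<in> X \<Longrightarrow> f x = y"
  shows "induced f X = y"
proof -
  have "f ` X = {y}" using assms by auto
  then show ?thesis by (simp add: induced_def)
qed

text \<open>\<open>the_elem\<close> in \<open>induced\<close> is meaningful only if the map is
  constant on the coset. The last hypothesis ensures this, since members of a coset of
  \<open>N\<close> differ by elements of \<open>N\<close>.\<close>

lemma induced_coset:
  assumes "free.subspace N" "free.subspace M" "flinear f" "\<And>q. q \<in> N \<Longrightarrow> f q \<in> M"
  shows "induced (\<lambda>p. f p +o M) (p +o N) = f p +o M"
proof (rule induced_eq)
  show "p +o N \<noteq> {}"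
    using free.subspace_0[OF assms(1)] by (auto simp: elt_set_plus_def)
  fix x assume "x \<in> p +o N"
  then show "f x +o M = f p +o M"
    using assms(4) unfolding coset_eq_iff[OF assms(2)]
    by (auto simp: elt_set_plus_def flinear_simps[OF assms(3)])
qed

section \<open>Multilinear maps on words\<close>

definition multilinear :: "('k::field \<Rightarrow> 'a::ab_group_add \<Rightarrow> 'a) \<Rightarrow> nat \<Rightarrow> ('a list \<Rightarrow> ('c \<Rightarrow>\<^sub>0 'k)) \<Rightarrow> bool"
  where "multilinear s n F \<longleftrightarrow> (\<forall>us x vs. length (us @ x # vs) = n \<longrightarrow>
    (\<forall>y. F (us @ (x + y) # vs) = F (us @ x # vs) + F (us @ y # vs)) \<and>
    (\<forall>c. F (us @ s c x # vs) = fscale c (F (us @ x # vs))))"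

definition alternating_words :: "nat \<Rightarrow> ('a list \<Rightarrow> 'c::zero) \<Rightarrow> bool"
  where "alternating_words n F \<longleftrightarrow> (\<forall>xs. length xs = n \<and> \<not> distinct xs \<longrightarrow> F xs = 0)"

lemma multilinear_iff_relators:
  assumes "flinear f"
  shows "multilinear s n (\<lambda>xs. f (basis xs)) \<longleftrightarrow> (\<forall>r \<in> multilinear_relators s n. f r = 0)"
proof -
  have add: "f (p - q - r) = 0 \<longleftrightarrow> f p = f q + f r" for p q r
    by (simp add: flinear_simps[OF assms] algebra_simps)
  have scale: "f (p - fscale c q) = 0 \<longleftrightarrow> f p = fscale c (f q)" for p c q
    by (simp add: flinear_simps[OF assms])
  show ?thesis
    unfolding multilinear_def multilinear_relators_def ball_Un add[symmetric] scale[symmetric]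
    by blast
qed

text \<open>A marked entry can only sit in one of finitely many slots. Listing the slots, here and
  for lengths 3 and 4, turns \<open>multilinear\<close> into explicit equations fit for
  rewriting.\<close>

lemma all_splits_2: "(\<forall>us x vs. length (us @ x # vs) = 2 \<longrightarrow> P us x vs) \<longleftrightarrow>
    (\<forall>x y. P [] x [y]) \<and>
    (\<forall>x y. P [x] y [])" (is "?L \<longleftrightarrow> ?R")
proof
  assume *: ?L
  show ?R
    using *[rule_format, of "[]" x "[y]" for x y]
      *[rule_format, of "[x]" y "[]" for x y]
    by simp
next
  assume *: ?R
  show ?L
  proof (intro allI impI)
    fix us vs and x :: 'a assume "length (us @ x # vs) = 2"
    with * show "P us x vs"
      by (cases us; cases vs) (auto simp: numeral_eq_Suc)
  qed
qed

lemma all_splits_3: "(\<forall>us x vs. length (us @ x # vs) = 3 \<longrightarrow> P us x vs) \<longleftrightarrow>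
    (\<forall>x y z. P [] x [y, z]) \<and>
    (\<forall>x y z. P [x] y [z]) \<and>
    (\<forall>x y z. P [x, y] z [])" (is "?L \<longleftrightarrow> ?R")
proof
  assume *: ?L
  show ?R
    using *[rule_format, of "[]" x "[y, z]" for x y z]
      *[rule_format, of "[x]" y "[z]" for x y z]
      *[rule_format, of "[x, y]" z "[]" for x y z]
    by simp
next
  assume *: ?R
  show ?L
  proof (intro allI impI)
    fix us vs and x :: 'a assume "length (us @ x # vs) = 3"
    with * show "P us x vs"
      by (cases us; cases "tl us"; cases vs; cases "tl vs") (auto simp: numeral_eq_Suc)
  qed
qed

lemma all_splits_4: "(\<forall>us x vs. length (us @ x # vs) = 4 \<longrightarrow> P us x vs) \<longleftrightarrow>
    (\<forall>x y z t. P [] x [y, z, t]) \<and>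
    (\<forall>x y z t. P [x] y [z, t]) \<and>
    (\<forall>x y z t. P [x, y] z [t]) \<and>
    (\<forall>x y z t. P [x, y, z] t [])" (is "?L \<longleftrightarrow> ?R")
proof
  assume *: ?L
  show ?R
    using *[rule_format, of "[]" x "[y, z, t]" for x y z t]
      *[rule_format, of "[x]" y "[z, t]" for x y z t]
      *[rule_format, of "[x, y]" z "[t]" for x y z t]
      *[rule_format, of "[x, y, z]" t "[]" for x y z t]
    by simp
next
  assume *: ?R
  show ?L
  proof (intro allI impI)
    fix us vs and x :: 'a assume "length (us @ x # vs) = 4"
    with * show "P us x vs"
      by (cases us; cases "tl us"; cases "tl (tl us)"; cases vs; cases "tl vs"; cases "tl (tl vs)")
        (auto simp: numeral_eq_Suc)
  qed
qed

lemma multilinear_2_iff: "multilinear s 2 F \<longleftrightarrow>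
    (\<forall>x x' y. F [x + x', y] = F [x, y] + F [x', y]) \<and>
    (\<forall>x y y'. F [x, y + y'] = F [x, y] + F [x, y']) \<and>
    (\<forall>c x y. F [s c x, y] = fscale c (F [x, y])) \<and>
    (\<forall>c x y. F [x, s c y] = fscale c (F [x, y]))"
  unfolding multilinear_def all_splits_2 append.simps
  by (intro iffI; intro conjI allI; simp)

lemma multilinear_3_iff: "multilinear s 3 F \<longleftrightarrow>
    (\<forall>x x' y z. F [x + x', y, z] = F [x, y, z] + F [x', y, z]) \<and>
    (\<forall>x y y' z. F [x, y + y', z] = F [x, y, z] + F [x, y', z]) \<and>
    (\<forall>x y z z'. F [x, y, z + z'] = F [x, y, z] + F [x, y, z']) \<and>
    (\<forall>c x y z. F [s c x, y, z] = fscale c (F [x, y, z])) \<and>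
    (\<forall>c x y z. F [x, s c y, z] = fscale c (F [x, y, z])) \<and>
    (\<forall>c x y z. F [x, y, s c z] = fscale c (F [x, y, z]))"
  unfolding multilinear_def all_splits_3 append.simps
  by (intro iffI; intro conjI allI; simp)

lemma multilinear_4_iff: "multilinear s 4 F \<longleftrightarrow>
    (\<forall>x x' y z t. F [x + x', y, z, t] = F [x, y, z, t] + F [x', y, z, t]) \<and>
    (\<forall>x y y' z t. F [x, y + y', z, t] = F [x, y, z, t] + F [x, y', z, t]) \<and>
    (\<forall>x y z z' t. F [x, y, z + z', t] = F [x, y, z, t] + F [x, y, z', t]) \<and>
    (\<forall>x y z t t'. F [x, y, z, t + t'] = F [x, y, z, t] + F [x, y, z, t']) \<and>
    (\<forall>c x y z t. F [s c x, y, z, t] = fscale c (F [x, y, z, t])) \<and>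
    (\<forall>c x y z t. F [x, s c y, z, t] = fscale c (F [x, y, z, t])) \<and>
    (\<forall>c x y z t. F [x, y, s c z, t] = fscale c (F [x, y, z, t])) \<and>
    (\<forall>c x y z t. F [x, y, z, s c t] = fscale c (F [x, y, z, t]))"
  unfolding multilinear_def all_splits_4 append.simps
  by (intro iffI; intro conjI allI; simp)

lemma alternating_3I:
  assumes "\<And>x z. F [x, x, z] = 0" "\<And>x y. F [x, y, x] = 0" "\<And>x y. F [x, y, y] = 0"
  shows "alternating_words 3 F"
  using assms by (auto simp: alternating_words_def numeral_eq_Suc length_Suc_conv)

lemma alternating_4I:
  assumes "\<And>x z t. F [x, x, z, t] = 0" "\<And>x y t. F [x, y, x, t] = 0" "\<And>x y z. F [x, y, z, x] = 0"
    "\<And>x y t. F [x, y, y, t] = 0" "\<And>x y z. F [x, y, z, y] = 0" "\<And>x y z. F [x, y, z, z] = 0"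
  shows "alternating_words 4 F"
  using assms by (auto simp: alternating_words_def numeral_eq_Suc length_Suc_conv)

text \<open>The universal property of the exterior power in terms of kernels. From left to right it
  yields calculation rules for a map with kernel \<open>ext_null\<close>; from right to left it
  shows that a map descends to the quotient.\<close>

lemma zero_on_ext_null_iff:
  assumes "flinear f"
  shows "(\<forall>p \<in> ext_null s n. f p = 0) \<longleftrightarrow>
    multilinear s n (\<lambda>xs. f (basis xs)) \<and> alternating_words n (\<lambda>xs. f (basis xs))"
  unfolding multilinear_iff_relators[OF assms] alternating_words_def ext_null_def
    zero_on_span_iff[OF assms] ball_Un by blast

lemma zero_on_tensor_null_iff:
  assumes "flinear f"
  shows "(\<forall>p \<in> tensor_null s n. f p = 0) \<longleftrightarrow> multilinear s n (\<lambda>xs. f (basis xs))"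
  unfolding multilinear_iff_relators[OF assms] tensor_null_def zero_on_span_iff[OF assms] ..

lemma zero_on_sym2_null_iff:
  assumes "flinear f"
  shows "(\<forall>p \<in> sym2_null s. f p = 0) \<longleftrightarrow>
    multilinear s 2 (\<lambda>xs. f (basis xs)) \<and> (\<forall>x y. f (basis [x, y]) = f (basis [y, x]))"
proof -
  have "f (p - q) = 0 \<longleftrightarrow> f p = f q" for p q
    by (simp add: flinear_diff[OF assms])
  then have "(\<forall>r \<in> {basis [x, y] - basis [y, x] | x y. True}. f r = 0) \<longleftrightarrow>
      (\<forall>x y. f (basis [x, y]) = f (basis [y, x]))"
    by blast
  then show ?thesis
    unfolding multilinear_iff_relators[OF assms] sym2_null_def zero_on_span_iff[OF assms] ball_Un
    by simp
qed

lemma subspace_nulls [simp]: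
  "free.subspace (ext_null s n)" "free.subspace (tensor_null s n)" "free.subspace (sym2_null s)"
  by (simp_all add: ext_null_def tensor_null_def sym2_null_def)

text \<open>Polarization: expanding the value at \<open>[x + y, x + y]\<close>, which vanishes,
  gives antisymmetry in every characteristic.\<close>

lemma alternating_swap_2:
  assumes "multilinear s 2 F" "alternating_words 2 F"
  shows "F [y, x] = - F [x, y]"
proof -
  have *: "F [u, u] = 0" for u
    using assms(2) by (simp add: alternating_words_def)
  have "F [x + y, x + y] = F [x, y] + F [y, x]"
    using assms(1) by (simp add: multilinear_2_iff *[of x] *[of y])
  then show ?thesis
    by (simp add: * eq_neg_iff_add_eq_0 add.commute)
qed

text \<open>In the boundary of a 4-word the bracket always stands first, so only the last two
  entries ever have to be reordered.\<close>

lemma alternating_swap_3: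
  assumes "multilinear s 3 F" "alternating_words 3 F"
  shows "F [x, z, y] = - F [x, y, z]"
proof -
  have *: "F [x, u, u] = 0" for u
    using assms(2) by (simp add: alternating_words_def)
  have "F [x, y + z, y + z] = F [x, y, z] + F [x, z, y]"
    using assms(1) by (simp add: multilinear_3_iff *[of y] *[of z])
  then show ?thesis
    by (simp add: * eq_neg_iff_add_eq_0 add.commute)
qed

section \<open>Boundaries and the Koszul map\<close>

context lie_algebra
begin

lemma bracket_linear:
  "bracket (x + y) z = bracket x z + bracket y z"
  "bracket x (y + z) = bracket x y + bracket x z"
  "bracket (scale c x) y = scale c (bracket x y)"
  "bracket x (scale c y) = scale c (bracket x y)"
  using linear_left linear_right by (simp_all add: Vector_Spaces.linear_iff)

lemma bracket_minus_right: "bracket x (- y) = - bracket x y"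
  using bracket_linear(4)[of x "- 1" y] by simp

lemma bracket_antisym: "bracket y x = - bracket x y"
proof -
  have "bracket (x + y) (x + y) = bracket x y + bracket y x"
    by (simp add: bracket_linear alternating[of x] alternating[of y])
  then show ?thesis
    by (simp add: alternating eq_neg_iff_add_eq_0 add.commute)
qed

section \<open>The Chevalley-Eilenberg boundary on exterior powers\<close>

lemma boundary_word_3:
  "boundary_word [x, y, z] =
    - basis [bracket x y, z] + basis [bracket x z, y] - basis [bracket y z, x]"
proof -
  have "{(i, j). i < j \<and> j < length [x, y, z]} = {(0, 1), (0, 2), (1, 2)}"
    by (auto simp: less_Suc_eq numeral_eq_Suc)
  then show ?thesis
    by (simp add: boundary_word_def nths_Cons fscale_minus_one)
qed

lemma boundary_word_4:
  "boundary_word [x, y, z, t] =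
    - basis [bracket x y, z, t] + basis [bracket x z, y, t] - basis [bracket x t, y, z]
    - basis [bracket y z, x, t] + basis [bracket y t, x, z] - basis [bracket z t, x, y]"
proof -
  have "{(i, j). i < j \<and> j < length [x, y, z, t]} =
      {(0, 1), (0, 2), (0, 3), (1, 2), (1, 3), (2, 3)}"
    by (auto simp: less_Suc_eq numeral_eq_Suc)
  then show ?thesis
    by (simp add: boundary_word_def nths_Cons fscale_minus_one numeral_eq_Suc)
qed

text \<open>Following the boundary by a map \<open>f\<close> with kernel
  \<open>ext_null scale 2\<close> turns well-definedness into multilinearity and alternation of the
  composite, both of which are checked on words.\<close>

lemma boundary_word_ext_null_3:
  assumes "p \<in> ext_null scale 3"
  shows "lin_extend boundary_word p \<in> ext_null scale 2"
proof -
  obtain f :: "('a list \<Rightarrow>\<^sub>0 'k) \<Rightarrow> ('a list \<Rightarrow>\<^sub>0 'k)"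
    where f: "flinear f" and ker: "\<And>p. f p = 0 \<longleftrightarrow> p \<in> ext_null scale 2"
    using subspace_kernel_of_flinear[of "ext_null scale 2"] by auto
  have ml: "multilinear scale 2 (\<lambda>xs. f (basis xs))" and alt: "alternating_words 2 (\<lambda>xs. f (basis xs))"
    using zero_on_ext_null_iff[OF f, of scale 2] ker by blast+
  note W = ml[unfolded multilinear_2_iff]
  have diag: "f (basis [u, u]) = 0" for u
    using alt by (simp add: alternating_words_def)
  have zero: "f (basis [0, u]) = 0" for u
    using W by (metis free.scale_zero_left scale_zero_left)
  have neg: "f (basis [- u, v]) = - f (basis [u, v])" for u v
    using W by (metis fscale_minus_one scale_minus_left scale_one)
  note simps = boundary_word_3 flinear_simps[OF f] flinear_simps[OF flinear_lin_extend]
  let ?g = "\<lambda>p. f (lin_extend boundary_word p)"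
  have g: "flinear ?g"
    by (rule flinear_comp[OF flinear_lin_extend f])
  have "multilinear scale 3 (\<lambda>xs. ?g (basis xs))"
    unfolding multilinear_3_iff
    by (simp add: simps W bracket_linear free.scale_right_distrib free.scale_right_diff_distrib)
  moreover have "alternating_words 3 (\<lambda>xs. ?g (basis xs))"
  proof (rule alternating_3I)
    show "?g (basis [x, x, z]) = 0" for x z
      by (simp add: simps alternating diag zero)
    show "?g (basis [x, y, x]) = 0" for x y
      by (simp add: simps alternating zero bracket_antisym[of y x] neg)
    show "?g (basis [x, y, y]) = 0" for x y
      by (simp add: simps alternating diag zero)
  qed
  ultimately have "?g p = 0"
    using zero_on_ext_null_iff[OF g] assms by blast
  then show ?thesis by (simp add: ker)
qed

lemma boundary_word_ext_null_4:
  assumes "p \<in> ext_null scale 4"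
  shows "lin_extend boundary_word p \<in> ext_null scale 3"
proof -
  obtain f :: "('a list \<Rightarrow>\<^sub>0 'k) \<Rightarrow> ('a list \<Rightarrow>\<^sub>0 'k)"
    where f: "flinear f" and ker: "\<And>p. f p = 0 \<longleftrightarrow> p \<in> ext_null scale 3"
    using subspace_kernel_of_flinear[of "ext_null scale 3"] by auto
  have ml: "multilinear scale 3 (\<lambda>xs. f (basis xs))" and alt: "alternating_words 3 (\<lambda>xs. f (basis xs))"
    using zero_on_ext_null_iff[OF f, of scale 3] ker by blast+
  note swap = alternating_swap_3[OF ml alt]
  note W = ml[unfolded multilinear_3_iff]
  have diag: "f (basis [u, u, v]) = 0" "f (basis [u, v, u]) = 0" "f (basis [v, u, u]) = 0" for u v
    using alt by (simp_all add: alternating_words_def)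
  have zero: "f (basis [0, u, v]) = 0" for u v
    using W by (metis free.scale_zero_left scale_zero_left)
  have neg: "f (basis [- u, v, w]) = - f (basis [u, v, w])" for u v w
    using W by (metis fscale_minus_one scale_minus_left scale_one)
  note simps = boundary_word_4 flinear_simps[OF f] flinear_simps[OF flinear_lin_extend]
  let ?g = "\<lambda>p. f (lin_extend boundary_word p)"
  have g: "flinear ?g"
    by (rule flinear_comp[OF flinear_lin_extend f])
  have "multilinear scale 4 (\<lambda>xs. ?g (basis xs))"
    unfolding multilinear_4_iff
    by (simp add: simps W bracket_linear free.scale_right_distrib free.scale_right_diff_distrib)
  \<comment> \<open>If two entries agree, their bracket is zero, the word still containing both
    vanishes, and the other four terms cancel in pairs.\<close>
  moreover have "alternating_words 4 (\<lambda>xs. ?g (basis xs))"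
  proof (rule alternating_4I)
    show "?g (basis [x, x, z, t]) = 0" for x z t
      by (simp add: simps alternating diag zero)
    show "?g (basis [x, y, x, t]) = 0" for x y t
      by (simp add: simps alternating diag zero bracket_antisym[of y x] neg
          swap[of _ t x] swap[of _ y x])
    show "?g (basis [x, y, z, x]) = 0" for x y z
      by (simp add: simps alternating diag zero bracket_antisym[of y x] bracket_antisym[of z x] neg
          swap[of _ z x] swap[of _ y x])
    show "?g (basis [x, y, y, t]) = 0" for x y t
      by (simp add: simps alternating diag zero)
    show "?g (basis [x, y, z, y]) = 0" for x y z
      by (simp add: simps alternating diag zero bracket_antisym[of z y] neg swap[of _ z y])
    show "?g (basis [x, y, z, z]) = 0" for x y z
      by (simp add: simps alternating diag zero)
  qed
  ultimately have "?g p = 0"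
    using zero_on_ext_null_iff[OF g] assms by blast
  then show ?thesis by (simp add: ker)
qed

lemma boundary_coset_3:
  "boundary 3 (p +o ext_null scale 3) = lin_extend boundary_word p +o ext_null scale 2"
  unfolding boundary_def by (simp add: induced_coset boundary_word_ext_null_3)

lemma boundary_coset_4:
  "boundary 4 (p +o ext_null scale 4) = lin_extend boundary_word p +o ext_null scale 3"
  unfolding boundary_def by (simp add: induced_coset boundary_word_ext_null_4)

section \<open>The Killing module as a quotient of words\<close>

lemma killing_word_3: "killing_word [x, y, z] = basis [bracket x y, z] - basis [x, bracket y z]"
  by (simp add: killing_word_def)

lemma koszul_word_3: "koszul_word [x, y, z] = basis [x, bracket y z]"
  by (simp add: koszul_word_def)

lemma killing_word_tensor_null:
  assumes "p \<in> tensor_null scale 3"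
  shows "lin_extend killing_word p \<in> sym2_null scale"
proof -
  obtain f :: "('a list \<Rightarrow>\<^sub>0 'k) \<Rightarrow> ('a list \<Rightarrow>\<^sub>0 'k)"
    where f: "flinear f" and ker: "\<And>p. f p = 0 \<longleftrightarrow> p \<in> sym2_null scale"
    using subspace_kernel_of_flinear[of "sym2_null scale"] by auto
  have "multilinear scale 2 (\<lambda>xs. f (basis xs))"
    using zero_on_sym2_null_iff[OF f, of scale] ker by blast
  note W = this[unfolded multilinear_2_iff]
  let ?g = "\<lambda>p. f (lin_extend killing_word p)"
  have g: "flinear ?g"
    by (rule flinear_comp[OF flinear_lin_extend f])
  have "multilinear scale 3 (\<lambda>xs. ?g (basis xs))"
    unfolding multilinear_3_iff
    by (simp add: killing_word_3 flinear_simps[OF f] W bracket_linear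
        free.scale_right_distrib free.scale_right_diff_distrib)
  then have "?g p = 0"
    using zero_on_tensor_null_iff[OF g] assms by blast
  then show ?thesis by (simp add: ker)
qed

text \<open>The words representing zero in the Killing module. That module is a quotient of a
  quotient; pulling \<open>killing_null\<close> back to words allows congruences to be tested in a
  single vector space.\<close>

definition killing_relations :: "('a list \<Rightarrow>\<^sub>0 'k) set"
  where "killing_relations = lin_extend killing_word ` words 3 + sym2_null scale"

lemma subspace_killing_relations [simp]: "free.subspace killing_relations"
proof -
  interpret Vector_Spaces.linear fscale fscale "lin_extend killing_word"
    by simp
  have "free.subspace (lin_extend killing_word ` words 3)"
    by (rule subspace_image) simp
  then have "free.subspace {x + y | x y. x \<in> lin_extend killing_word ` words 3 \<and> y \<in> sym2_null scale}"
    by (rule free.subspace_sums) simp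
  moreover have "{x + y | x y. x \<in> lin_extend killing_word ` words 3 \<and> y \<in> sym2_null scale}
      = killing_relations"
    by (auto simp: killing_relations_def set_plus_def)
  ultimately show ?thesis by simp
qed

lemma killing_image_subset_relations: "lin_extend killing_word ` words 3 \<subseteq> killing_relations"
  unfolding killing_relations_def
  using set_zero_plus2[OF free.subspace_0[OF subspace_nulls(3)]] by (metis add.commute)

lemma sym2_null_subset_relations: "sym2_null scale \<subseteq> killing_relations"
proof -
  have "lin_extend killing_word 0 \<in> lin_extend killing_word ` words 3"
    by (intro imageI free.subspace_0) simp
  then have "0 \<in> lin_extend killing_word ` words 3"
    by (simp only: lin_extend_simps)
  then show ?thesis
    unfolding killing_relations_def by (rule set_zero_plus2)
qed

lemma killing_word_in_relations:
  assumes "length xs = 3"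
  shows "killing_word xs \<in> killing_relations"
proof -
  have "lin_extend killing_word (basis xs) \<in> lin_extend killing_word ` words 3"
    by (intro imageI basis_in_words assms)
  then show ?thesis
    using killing_image_subset_relations by auto
qed

text \<open>A summand from \<open>sym2_null scale\<close> does not change a coset, so passing from
  the image of \<open>killing_word\<close> to \<open>killing_relations\<close> adds no new
  cosets.\<close>

lemma killing_null_eq: "killing_null = quot killing_relations (sym2_null scale)"
proof -
  have "killing_null = quot (lin_extend killing_word ` words 3) (sym2_null scale)"
    unfolding killing_null_def tensor_power_def quot_def image_image
    by (simp add: killing_map_def induced_coset killing_word_tensor_null)
  also have "\<dots> = quot killing_relations (sym2_null scale)"
  proof
    show "quot (lin_extend killing_word ` words 3) (sym2_null scale)
        \<subseteq> quot killing_relations (sym2_null scale)"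
      unfolding quot_def by (intro image_mono killing_image_subset_relations)
    show "quot killing_relations (sym2_null scale)
        \<subseteq> quot (lin_extend killing_word ` words 3) (sym2_null scale)"
    proof
      fix X assume "X \<in> quot killing_relations (sym2_null scale)"
      then obtain r s where rs: "r \<in> lin_extend killing_word ` words 3" "s \<in> sym2_null scale"
        "X = (r + s) +o sym2_null scale"
        by (auto simp: quot_def killing_relations_def set_plus_def)
      then have "X = r +o sym2_null scale"
        by (simp add: coset_eq_iff)
      with rs show "X \<in> quot (lin_extend killing_word ` words 3) (sym2_null scale)"
        by (auto simp: quot_def)
    qed
  qed
  finally show ?thesis .
qed

text \<open>The third isomorphism theorem on the level of elements: a coset of cosets is governed by
  the class of \<open>p\<close> modulo \<open>killing_relations\<close>.\<close>

lemma killing_coset_eq: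
  "(p +o sym2_null scale) +o killing_null = {q +o sym2_null scale | q. q - p \<in> killing_relations}"
proof -
  have "(p +o sym2_null scale) +o killing_null
      = (\<lambda>r. (p + r) +o sym2_null scale) ` killing_relations"
    by (auto simp: killing_null_eq quot_def elt_set_plus_def[of "p +o sym2_null scale"]
        coset_plus_coset)
  also have "\<dots> = {q +o sym2_null scale | q. q - p \<in> killing_relations}"
    by (force simp: image_iff)
  finally show ?thesis .
qed

lemma killing_coset_cong:
  assumes "p - q \<in> killing_relations"
  shows "(p +o sym2_null scale) +o killing_null = (q +o sym2_null scale) +o killing_null"
proof -
  have "r - p \<in> killing_relations \<longleftrightarrow> r - q \<in> killing_relations" for r
  proof -
    have "r - q = (r - p) + (p - q)" "r - p = (r - q) - (p - q)" by simp_all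
    then show ?thesis
      using assms free.subspace_add free.subspace_diff subspace_killing_relations by metis
  qed
  then show ?thesis by (simp add: killing_coset_eq)
qed

text \<open>The coset contains its own representative, so \<open>p\<close> agrees modulo
  \<open>sym2_null scale\<close> with some relation. This is the direction that detects nonzero
  values of the Koszul map.\<close>

lemma killing_coset_zero:
  assumes "(p +o sym2_null scale) +o killing_null = killing_null"
  shows "p \<in> killing_relations"
proof -
  have "p +o sym2_null scale \<in> (p +o sym2_null scale) +o killing_null"
    unfolding killing_coset_eq by (auto intro!: exI[of _ p] free.subspace_0)
  then obtain r where r: "r \<in> killing_relations" "p +o sym2_null scale = r +o sym2_null scale"
    unfolding assms by (auto simp: killing_null_eq quot_def)
  then have "p - r \<in> killing_relations"
    using sym2_null_subset_relations by (auto simp: coset_eq_iff)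
  then have "(p - r) + r \<in> killing_relations"
    using r(1) by (intro free.subspace_add) simp_all
  then show ?thesis by simp
qed

text \<open>In effect the universal invariant symmetric bilinear form, sending \<open>x\<close>,
  \<open>y\<close> to the class of x \<odot> y, with its values realised in the space of words
  instead of the Killing module.\<close>

lemma killing_form_modulo_relations:
  obtains f :: "('a list \<Rightarrow>\<^sub>0 'k) \<Rightarrow> ('a list \<Rightarrow>\<^sub>0 'k)" where
    "flinear f" "\<And>p. f p = 0 \<longleftrightarrow> p \<in> killing_relations"
    "multilinear scale 2 (\<lambda>xs. f (basis xs))"
    "\<And>x y. f (basis [y, x]) = f (basis [x, y])"
    "\<And>x y z. f (basis [bracket x y, z]) = f (basis [x, bracket y z])"
proof -
  obtain f :: "('a list \<Rightarrow>\<^sub>0 'k) \<Rightarrow> ('a list \<Rightarrow>\<^sub>0 'k)"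
    where f: "flinear f" and ker: "\<And>p. f p = 0 \<longleftrightarrow> p \<in> killing_relations"
    using subspace_kernel_of_flinear[of killing_relations] by auto
  have "\<forall>p \<in> sym2_null scale. f p = 0"
    using sym2_null_subset_relations ker by blast
  note this[unfolded zero_on_sym2_null_iff[OF f]]
  moreover have "f (basis [bracket x y, z]) = f (basis [x, bracket y z])" for x y z
    using killing_word_in_relations[of "[x, y, z]"]
    by (simp add: ker[symmetric] killing_word_3 flinear_simps[OF f])
  ultimately show thesis
    using that[OF f ker] by metis
qed

text \<open>Invariance moves the bracket onto the repeated entry: x \<odot> [x,z] = [x,x] \<odot> z
  = 0, and by symmetry x \<odot> [y,x] = [y,x] \<odot> x = y \<odot> [x,x] = 0.\<close>

lemma koszul_word_ext_null:
  assumes "p \<in> ext_null scale 3"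
  shows "lin_extend koszul_word p \<in> killing_relations"
proof -
  obtain f :: "('a list \<Rightarrow>\<^sub>0 'k) \<Rightarrow> ('a list \<Rightarrow>\<^sub>0 'k)" where f: "flinear f"
    and ker: "\<And>p. f p = 0 \<longleftrightarrow> p \<in> killing_relations"
    and ml: "multilinear scale 2 (\<lambda>xs. f (basis xs))"
    and sym: "\<And>x y. f (basis [y, x]) = f (basis [x, y])"
    and inv: "\<And>x y z. f (basis [bracket x y, z]) = f (basis [x, bracket y z])"
    by (rule killing_form_modulo_relations) blast
  note W = ml[unfolded multilinear_2_iff]
  have zero: "f (basis [u, 0]) = 0" "f (basis [0, u]) = 0" for u
    using W by (metis free.scale_zero_left scale_zero_left)+
  let ?g = "\<lambda>p. f (lin_extend koszul_word p)"
  have g: "flinear ?g"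
    by (rule flinear_comp[OF flinear_lin_extend f])
  have "multilinear scale 3 (\<lambda>xs. ?g (basis xs))"
    unfolding multilinear_3_iff by (simp add: koszul_word_3 W bracket_linear)
  moreover have "alternating_words 3 (\<lambda>xs. ?g (basis xs))"
  proof (rule alternating_3I)
    show "?g (basis [x, x, z]) = 0" for x z
      using inv[of x x z] by (simp add: koszul_word_3 alternating zero)
    show "?g (basis [x, y, x]) = 0" for x y
      using inv[of y x x] by (simp add: koszul_word_3 alternating zero sym[of x])
    show "?g (basis [x, y, y]) = 0" for x y
      by (simp add: koszul_word_3 alternating zero)
  qed
  ultimately have "?g p = 0"
    using zero_on_ext_null_iff[OF g] assms by blast
  then show ?thesis by (simp add: ker)
qed

section \<open>The Koszul map on cosets and on homology\<close>

lemma koszul_map_coset: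
  "koszul_map (p +o ext_null scale 3) = (lin_extend koszul_word p +o sym2_null scale) +o killing_null"
  unfolding koszul_map_def
proof (rule induced_eq)
  show "p +o ext_null scale 3 \<noteq> {}"
    using free.subspace_0[OF subspace_nulls(1)] by (auto simp: elt_set_plus_def)
  fix q assume "q \<in> p +o ext_null scale 3"
  then obtain r where "r \<in> ext_null scale 3" "q = p + r"
    by (auto simp: elt_set_plus_def)
  then show "(lin_extend koszul_word q +o sym2_null scale) +o killing_null
      = (lin_extend koszul_word p +o sym2_null scale) +o killing_null"
    by (intro killing_coset_cong) (simp add: lin_extend_simps koszul_word_ext_null)
qed

text \<open>The boundary of a 4-word is sent to products of two brackets. Invariance extracts
  \<open>x\<close> from each of them, which leaves a multiple of the product of \<open>x\<close>
  with the Jacobi sum of \<open>y\<close>, \<open>z\<close>, \<open>t\<close>.\<close>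

lemma koszul_boundary:
  assumes "q \<in> words 4"
  shows "lin_extend koszul_word (lin_extend boundary_word q) \<in> killing_relations"
proof -
  obtain f :: "('a list \<Rightarrow>\<^sub>0 'k) \<Rightarrow> ('a list \<Rightarrow>\<^sub>0 'k)" where f: "flinear f"
    and ker: "\<And>p. f p = 0 \<longleftrightarrow> p \<in> killing_relations"
    and ml: "multilinear scale 2 (\<lambda>xs. f (basis xs))"
    and sym: "\<And>x y. f (basis [y, x]) = f (basis [x, y])"
    and inv: "\<And>x y z. f (basis [bracket x y, z]) = f (basis [x, bracket y z])"
    by (rule killing_form_modulo_relations) blast
  note W = ml[unfolded multilinear_2_iff]
  have zero: "f (basis [u, 0]) = 0" for u
    using W by (metis free.scale_zero_left scale_zero_left)
  have neg: "f (basis [u, - v]) = - f (basis [u, v])" for u v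
    using W by (metis fscale_minus_one scale_minus_left scale_one)
  let ?g = "\<lambda>p. f (lin_extend koszul_word (lin_extend boundary_word p))"
  have g: "flinear ?g"
    by (intro flinear_comp[OF flinear_comp f] flinear_lin_extend)
  have "?g (basis [x, y, z, t]) = 0" for x y z t
  proof -
    let ?A = "f (basis [x, bracket y (bracket z t)])"
      and ?B = "f (basis [x, bracket z (bracket t y)])"
      and ?C = "f (basis [x, bracket t (bracket y z)])"
    have "?A + ?B + ?C = 0"
      using W jacobi[of y z t] zero[of x] by metis
    moreover have "f (basis [bracket x y, bracket z t]) = ?A"
      "f (basis [bracket x z, bracket y t]) = - ?B"
      "f (basis [bracket x t, bracket y z]) = ?C"
      by (simp_all add: inv bracket_antisym[of y t] bracket_minus_right neg)
    \<comment> \<open>By symmetry, complementary pairs of positions have the same image; hence the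
      same sum occurs twice.\<close>
    moreover have "?g (basis [x, y, z, t]) = - (f (basis [bracket x y, bracket z t])
        - f (basis [bracket x z, bracket y t]) + f (basis [bracket x t, bracket y z]))
        - (f (basis [bracket x y, bracket z t])
        - f (basis [bracket x z, bracket y t]) + f (basis [bracket x t, bracket y z]))"
      by (simp add: boundary_word_4 lin_extend_simps flinear_simps[OF f] koszul_word_3
          sym[of "bracket x y"] sym[of "bracket x z"] sym[of "bracket x t"])
    ultimately show ?thesis by (simp add: algebra_simps)
  qed
  then have "\<forall>r \<in> basis ` {xs. length xs = 4}. ?g r = 0"
    by (auto simp: numeral_eq_Suc length_Suc_conv)
  then have "?g q = 0"
    using assms zero_on_span_iff[OF g] unfolding words_eq_span by blast
  then show ?thesis by (simp add: ker)
qed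

text \<open>The members of the class are represented by \<open>p\<close> plus boundaries of 4-words,
  and \<open>koszul_boundary\<close> puts the images of the latter into
  \<open>killing_relations\<close>. So the value can be computed from \<open>p\<close>.\<close>

lemma reduced_koszul_map_coset:
  "reduced_koszul_map ((p +o ext_null scale 3) +o boundaries 3) =
    (lin_extend koszul_word p +o sym2_null scale) +o killing_null"
  unfolding reduced_koszul_map_def
proof (rule induced_eq)
  have boundaries: "boundaries 3 = (\<lambda>q. lin_extend boundary_word q +o ext_null scale 3) ` words 4"
    by (simp add: boundaries_def ext_power_def quot_def image_image boundary_coset_4)
  have "0 \<in> words 4"
    by (rule free.subspace_0) simp
  then show "(p +o ext_null scale 3) +o boundaries 3 \<noteq> {}"
    unfolding boundaries elt_set_plus_def by blast
  fix X assume "X \<in> (p +o ext_null scale 3) +o boundaries 3"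
  then obtain q where q: "q \<in> words 4"
    and "X = (p +o ext_null scale 3) + (lin_extend boundary_word q +o ext_null scale 3)"
    unfolding boundaries elt_set_plus_def[of "p +o ext_null scale 3"] by blast
  then have X: "X = (p + lin_extend boundary_word q) +o ext_null scale 3"
    by (simp add: coset_plus_coset)
  then show "koszul_map X = (lin_extend koszul_word p +o sym2_null scale) +o killing_null"
    using koszul_boundary[OF q] unfolding X koszul_map_coset
    by (intro killing_coset_cong) (simp add: lin_extend_simps)
qed

text \<open>Symmetry and invariance make \<open>B\<close> a functional on the Killing module. Its
  composite with the Koszul map is the Cartan 3-form, so a nonzero value on a cycle forces a nonzero
  image. Scalars are coded as multiples of the single generator \<open>()\<close>, which makes
  functionals instances of \<open>flinear\<close>.\<close>

theorem reduced_koszul_map_nonzero: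
  fixes B :: "'a \<Rightarrow> 'a \<Rightarrow> 'k"
  assumes B_add: "\<And>x x' y. B (x + x') y = B x y + B x' y"
    and B_scale: "\<And>c x y. B (scale c x) y = c * B x y"
    and B_sym: "\<And>x y. B x y = B y x"
    and B_invariant: "\<And>x y z. B (bracket x y) z = B x (bracket y z)"
    and w: "w \<in> words 3"
    and cycle: "lin_extend boundary_word w \<in> ext_null scale 2"
    and eval: "lin_extend (\<lambda>xs. Poly_Mapping.single () (B (xs ! 0) (bracket (xs ! 1) (xs ! 2)))) w \<noteq> 0"
  shows "\<exists>h \<in> homology 3. reduced_koszul_map h \<noteq> killing_null"
proof
  define f where "f = lin_extend (\<lambda>xs. Poly_Mapping.single () (B (xs ! 0) (xs ! 1)))"
  have f: "flinear f"
    by (simp add: f_def)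
  have f_basis: "f (basis [x, y]) = Poly_Mapping.single () (B x y)" for x y
    by (simp add: f_def)
  have "multilinear scale 2 (\<lambda>xs. f (basis xs))"
    unfolding multilinear_2_iff f_basis fscale_single
    by (metis B_add B_scale B_sym single_add)
  then have f_sym2: "f p = 0" if "p \<in> sym2_null scale" for p
    using zero_on_sym2_null_iff[OF f] that B_sym unfolding f_basis by metis
  have fk: "flinear (\<lambda>p. f (lin_extend killing_word p))"
    by (rule flinear_comp[OF flinear_lin_extend f])
  have "\<forall>r \<in> basis ` {xs. length xs = 3}. f (lin_extend killing_word r) = 0"
    by (auto simp: numeral_eq_Suc length_Suc_conv killing_word_3 flinear_simps[OF f] f_basis B_invariant)
  then have f_killing: "f (lin_extend killing_word p) = 0" if "p \<in> words 3" for p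
    using that zero_on_span_iff[OF fk] unfolding words_eq_span by blast
  have f_relations: "f p = 0" if "p \<in> killing_relations" for p
    using that by (auto simp: killing_relations_def set_plus_def flinear_add[OF f] f_sym2 f_killing)
  have koszul: "f (lin_extend koszul_word p) =
      lin_extend (\<lambda>xs. Poly_Mapping.single () (B (xs ! 0) (bracket (xs ! 1) (xs ! 2)))) p"
    (is "_ = ?g p") if "p \<in> words 3" for p
  proof -
    have "flinear (\<lambda>p. f (lin_extend koszul_word p) - ?g p)"
      by (rule flinearI) (simp_all add: flinear_simps[OF f] lin_extend_simps free.scale_right_diff_distrib)
    moreover have "\<forall>r \<in> basis ` {xs. length xs = 3}. f (lin_extend koszul_word r) - ?g r = 0"
      by (auto simp: numeral_eq_Suc length_Suc_conv koszul_word_3 f_basis)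
    ultimately have "f (lin_extend koszul_word p) - ?g p = 0"
      using that zero_on_span_iff unfolding words_eq_span by blast
    then show ?thesis by simp
  qed
  show "reduced_koszul_map ((w +o ext_null scale 3) +o boundaries 3) \<noteq> killing_null"
    using f_relations killing_coset_zero koszul[OF w] eval
    unfolding reduced_koszul_map_coset by metis
  have "w +o ext_null scale 3 \<in> cycles 3"
    using w cycle by (auto simp: cycles_def ext_power_def quot_def boundary_coset_3 coset_eq_self_iff)
  then show "(w +o ext_null scale 3) +o boundaries 3 \<in> homology 3"
    by (auto simp: homology_def quot_def)
qed

end

section \<open>The 12-dimensional Lie algebra\<close>

text \<open>The type \<open>12\<close> consists of the residues 0 to 11, so equations between
  vectors split into twelve scalar ones.\<close>

lemma forall_12: "(\<forall>i::12. P i) \<longleftrightarrow>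
  P 0 \<and> P 1 \<and> P 2 \<and> P 3 \<and> P 4 \<and> P 5 \<and> P 6 \<and> P 7 \<and> P 8 \<and> P 9 \<and> P 10 \<and> P 11"
proof
  assume *: "P 0 \<and> P 1 \<and> P 2 \<and> P 3 \<and> P 4 \<and> P 5 \<and> P 6 \<and> P 7 \<and> P 8 \<and> P 9 \<and> P 10 \<and> P 11"
  show "\<forall>i. P i"
  proof
    fix i :: 12
    obtain z where z: "i = of_int z" "0 \<le> z" "z < 12"
      by (cases i) auto
    then have "z = 0 \<or> z = 1 \<or> z = 2 \<or> z = 3 \<or> z = 4 \<or> z = 5 \<or> z = 6 \<or> z = 7 \<or> z = 8 \<or>
        z = 9 \<or> z = 10 \<or> z = 11"
      by arith
    with * z(1) show "P i" by auto
  qed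
qed simp

definition e :: "12 \<Rightarrow> 'k::field ^ 12"
  where "e k = axis k 1"

lemma e_nth: "e k $ i = (if i = k then 1 else 0)"
  by (simp add: e_def axis_def)

text \<open>The vectors \<open>e 0, \<dots>, e 5\<close> span \<open>\<aa>\<close>, and \<open>e (6 + i)\<close> is the element \<open>e\<^sup>i\<close> of the dual basis.\<close>

definition lie_bracket :: "'k::field ^ 12 \<Rightarrow> 'k ^ 12 \<Rightarrow> 'k ^ 12"
  where "lie_bracket x y = (let m = (\<lambda>i j. x $ i * y $ j - x $ j * y $ i) in
    m 0 1 *s e 2 + m 0 2 *s (e 3 + e 10) + m 0 3 *s (e 5 + e 11) + m 1 2 *s e 4 + m 1 4 *s (e 11 - e 5)
    - m 0 4 *s e 8 - m 0 5 *s e 9 - m 0 8 *s e 7 - m 0 9 *s e 8 - m 0 11 *s e 9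
    - m 1 5 *s e 10 + m 1 8 *s e 6 - m 1 10 *s e 8 + m 1 11 *s e 10
    + m 2 4 *s e 6 + m 2 9 *s e 6 + m 2 10 *s e 7
    + m 3 5 *s e 6 + m 3 11 *s e 6 + m 4 5 *s e 7 - m 4 11 *s e 7)"

text \<open>Coordinates 0 to 5 give the bracket of \<open>\<aa>\<close>; coordinates 6 to 11 combine
  the coadjoint action with the contractions of \<open>\<theta>\<close>. No product of two dual
  coordinates occurs, so the dual is an abelian ideal.\<close>

lemma lie_bracket_nth:
  fixes x y :: "'k::field ^ 12"
  defines "m \<equiv> \<lambda>i j. x $ i * y $ j - x $ j * y $ i"
  shows "lie_bracket x y $ 0 = 0" "lie_bracket x y $ 1 = 0"
    "lie_bracket x y $ 2 = m 0 1" "lie_bracket x y $ 3 = m 0 2" "lie_bracket x y $ 4 = m 1 2"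
    "lie_bracket x y $ 5 = m 0 3 - m 1 4"
    "lie_bracket x y $ 6 = m 1 8 + m 2 4 + m 2 9 + m 3 5 + m 3 11"
    "lie_bracket x y $ 7 = m 2 10 + m 4 5 - m 0 8 - m 4 11"
    "lie_bracket x y $ 8 = - m 0 4 - m 0 9 - m 1 10"
    "lie_bracket x y $ 9 = - m 0 5 - m 0 11"
    "lie_bracket x y $ 10 = m 0 2 - m 1 5 + m 1 11"
    "lie_bracket x y $ 11 = m 0 3 + m 1 4"
  unfolding lie_bracket_def Let_def m_def by (simp_all add: e_nth)

text \<open>For such an extension the Jacobi identity amounts to that of \<open>\<aa>\<close>
  together with closedness of \<open>\<theta>\<close>. In coordinates these are polynomial
  identities valid over every field.\<close>

lemma lie_algebra_lie_bracket: "lie_algebra (*s) (lie_bracket :: 'k::field ^ 12 \<Rightarrow> _)"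
proof (intro lie_algebra.intro vec.vector_space_axioms lie_algebra_axioms.intro)
  fix x y z :: "'k ^ 12"
  show "Vector_Spaces.linear (*s) (*s) (\<lambda>x. lie_bracket x y)"
    "Vector_Spaces.linear (*s) (*s) (lie_bracket x)"
    by (simp_all add: Vector_Spaces.linear_iff vec.vector_space_axioms vec_eq_iff forall_12
        lie_bracket_nth algebra_simps)
  show "lie_bracket x x = 0"
    by (simp add: vec_eq_iff forall_12 lie_bracket_nth)
  show "lie_bracket x (lie_bracket y z) + lie_bracket y (lie_bracket z x)
      + lie_bracket z (lie_bracket x y) = 0"
    by (simp add: vec_eq_iff forall_12 lie_bracket_nth algebra_simps)
qed

interpretation L: lie_algebra "(*s)" "lie_bracket :: 'k::field ^ 12 \<Rightarrow> _"
  by (rule lie_algebra_lie_bracket)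

section \<open>Nilpotency\<close>

definition coordinate_subspace :: "12 set \<Rightarrow> ('k::field ^ 12) set"
  where "coordinate_subspace I = {x. \<forall>i\<in>I. x $ i = 0}"

lemma lower_central_subset:
  assumes "(L.lower_central (Suc n) :: ('k::field ^ 12) set) \<subseteq> coordinate_subspace I"
    and "\<And>x y :: 'k ^ 12. y \<in> coordinate_subspace I \<Longrightarrow> lie_bracket x y \<in> coordinate_subspace J"
  shows "(L.lower_central (Suc (Suc n)) :: ('k ^ 12) set) \<subseteq> coordinate_subspace J"
proof -
  have "vec.subspace (coordinate_subspace J :: ('k ^ 12) set)"
    by (auto simp: vec.subspace_def coordinate_subspace_def)
  then show ?thesis
    unfolding L.lower_central.simps using assms by (intro vec.span_minimal) auto
qed

text \<open>Let \<open>e i\<close> keep its weight in \<open>\<aa>\<close> and give the dual of a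
  vector of weight \<open>i\<close> the weight \<open>8 - i\<close>. The part of
  \<open>\<theta>\<close> of weight 8 respects these weights and the part of weight 6 raises them by
  2. Hence the \<open>n\<close>-th term of the series lives in weights at least \<open>n\<close>:
  the listed vanishing coordinates are those of weight below \<open>n\<close>. The top weight is 7,
  attained by \<open>e 6\<close> and \<open>e 7\<close>, so the eighth term is zero.\<close>

lemma nilpotent_lie_bracket: "lie_algebra.nilpotent (*s) (lie_bracket :: 'k::field ^ 12 \<Rightarrow> _) 7"
proof -
  let ?C = "L.lower_central :: nat \<Rightarrow> ('k ^ 12) set"
  note simps = coordinate_subspace_def lie_bracket_nth
  have "?C (Suc 0) \<subseteq> coordinate_subspace {}"
    by (simp add: coordinate_subspace_def)
  then have "?C (Suc (Suc 0)) \<subseteq> coordinate_subspace {0, 1}"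
    by (rule lower_central_subset) (simp add: simps)
  then have "?C (Suc (Suc (Suc 0))) \<subseteq> coordinate_subspace {0, 1, 2}"
    by (rule lower_central_subset) (simp add: simps)
  then have "?C (Suc (Suc (Suc (Suc 0)))) \<subseteq> coordinate_subspace {0, 1, 2, 3, 4}"
    by (rule lower_central_subset) (simp add: simps)
  then have "?C (Suc (Suc (Suc (Suc (Suc 0))))) \<subseteq> coordinate_subspace {0, 1, 2, 3, 4, 5, 11}"
    by (rule lower_central_subset) (simp add: simps)
  then have "?C (Suc (Suc (Suc (Suc (Suc (Suc 0)))))) \<subseteq> coordinate_subspace {0, 1, 2, 3, 4, 5, 9, 10, 11}"
    by (rule lower_central_subset) (simp add: simps)
  then have "?C (Suc (Suc (Suc (Suc (Suc (Suc (Suc 0))))))) \<subseteq> coordinate_subspace (- {6, 7})"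
    by (rule lower_central_subset) (simp add: simps Ball_def forall_12)
  then have "?C (Suc (Suc (Suc (Suc (Suc (Suc (Suc (Suc 0)))))))) \<subseteq> coordinate_subspace UNIV"
    by (rule lower_central_subset) (simp add: simps Ball_def forall_12)
  moreover have "coordinate_subspace UNIV = {0 :: 'k ^ 12}"
    by (auto simp: coordinate_subspace_def vec_eq_iff)
  moreover have "0 \<in> ?C (Suc (Suc (Suc (Suc (Suc (Suc (Suc (Suc 0))))))))"
    unfolding L.lower_central.simps by (rule vec.span_zero)
  ultimately have "?C (Suc (Suc (Suc (Suc (Suc (Suc (Suc (Suc 0)))))))) = {0}"
    by blast
  then show ?thesis
    unfolding L.nilpotent_def by (simp add: eval_nat_numeral del: L.lower_central.simps)
qed

section \<open>The invariant form\<close>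

definition hyperbolic_form :: "'k::field ^ 12 \<Rightarrow> 'k ^ 12 \<Rightarrow> 'k"
  where "hyperbolic_form x y =
    x $ 0 * y $ 6 + x $ 1 * y $ 7 + x $ 2 * y $ 8 + x $ 3 * y $ 9 + x $ 4 * y $ 10 + x $ 5 * y $ 11 +
    x $ 6 * y $ 0 + x $ 7 * y $ 1 + x $ 8 * y $ 2 + x $ 9 * y $ 3 + x $ 10 * y $ 4 + x $ 11 * y $ 5"

lemma hyperbolic_form_add: "hyperbolic_form (x + x') y = hyperbolic_form x y + hyperbolic_form x' y"
  by (simp add: hyperbolic_form_def algebra_simps)

lemma hyperbolic_form_scale: "hyperbolic_form (c *s x) y = c * hyperbolic_form x y"
  by (simp add: hyperbolic_form_def algebra_simps)

lemma hyperbolic_form_sym: "hyperbolic_form x y = hyperbolic_form y x"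
  by (simp add: hyperbolic_form_def algebra_simps)

text \<open>The coadjoint action is defined so as to make the pairing invariant, and the
  contribution of \<open>\<theta>\<close> is invariant because \<open>\<theta>\<close> is
  alternating.\<close>

lemma hyperbolic_form_invariant:
  "hyperbolic_form (lie_bracket x y) z = hyperbolic_form x (lie_bracket y z)"
  by (simp add: hyperbolic_form_def lie_bracket_nth algebra_simps)

section \<open>An explicit 3-cycle\<close>

lemma lie_bracket_e:
  "lie_bracket (e 0) (e 1) = e 2"
  "lie_bracket (e 0) (e 2) = e 3 + e 10"
  "lie_bracket (e 0) (e 3) = e 5 + e 11"
  "lie_bracket (e 0) (e 4) = - e 8"
  "lie_bracket (e 0) (e 5) = - e 9"
  "lie_bracket (e 0) (e 8) = - e 7"
  "lie_bracket (e 0) (e 9) = - e 8"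
  "lie_bracket (e 0) (e 10) = 0"
  "lie_bracket (e 1) (e 2) = e 4"
  "lie_bracket (e 1) (e 3) = 0"
  "lie_bracket (e 1) (e 4) = e 11 - e 5"
  "lie_bracket (e 1) (e 8) = e 6"
  "lie_bracket (e 1) (e 10) = - e 8"
  "lie_bracket (e 1) (e 11) = e 10"
  "lie_bracket (e 2) (e 3) = 0"
  "lie_bracket (e 2) (e 4) = e 6"
  "lie_bracket (e 2) (e 9) = e 6"
  "lie_bracket (e 2) (e 10) = e 7"
  "lie_bracket (e 3) (e 5) = e 6"
  "lie_bracket (e 4) (e 11) = - e 7"
  "lie_bracket (e 5) (e 10) = 0"
  by (simp_all add: lie_bracket_def e_nth)

text \<open>The Cartan form is nonzero on six of the words. Their boundaries consist of products of
  some \<open>e i\<close> with its dual \<open>e (6 + i)\<close>, apart from multiples of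
  \<open>e 3\<close> \<and> \<open>e 4\<close> and \<open>e 9\<close> \<and> \<open>e 10\<close>.
  Cancelling the six dual products gives linear equations that determine the six coefficients up to
  a common factor. The words \<open>[e 1, e 2, e 3]\<close> and \<open>[e 0, e 5, e 10]\<close>, on
  which the form is zero, remove the two remaining products.\<close>

definition koszul_cycle :: "('k::field ^ 12) list \<Rightarrow>\<^sub>0 'k"
  where "koszul_cycle =
    basis [e 1, e 2, e 10] - fscale 3 (basis [e 0, e 3, e 5]) + fscale 4 (basis [e 0, e 2, e 4])
    + fscale 4 (basis [e 1, e 2, e 3]) - fscale 3 (basis [e 0, e 2, e 9])
    + fscale 2 (basis [e 0, e 1, e 8]) + fscale 3 (basis [e 1, e 4, e 11])
    + fscale 3 (basis [e 0, e 5, e 10])"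

lemma koszul_cycle_in_words: "koszul_cycle \<in> words 3"
  unfolding koszul_cycle_def
  by (intro free.subspace_add free.subspace_diff free.subspace_scale subspace_words basis_in_words) simp_all

lemma boundary_koszul_cycle:
  "lin_extend L.boundary_word (koszul_cycle :: ('k::field ^ 12) list \<Rightarrow>\<^sub>0 'k) \<in> ext_null (*s) 2"
proof -
  obtain f :: "(('k ^ 12) list \<Rightarrow>\<^sub>0 'k) \<Rightarrow> (('k ^ 12) list \<Rightarrow>\<^sub>0 'k)"
    where f: "flinear f" and ker: "\<And>p. f p = 0 \<longleftrightarrow> p \<in> ext_null (*s) 2"
    using subspace_kernel_of_flinear[of "ext_null (*s) 2"] by auto
  have ml: "multilinear (*s) 2 (\<lambda>xs. f (basis xs))" and alt: "alternating_words 2 (\<lambda>xs. f (basis xs))"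
    using zero_on_ext_null_iff[OF f, of "(*s)"] ker by blast+
  note swap = alternating_swap_2[OF ml alt]
  have add: "f (basis [x + x', y]) = f (basis [x, y]) + f (basis [x', y])"
    and scale: "f (basis [c *s x, y]) = fscale c (f (basis [x, y]))" for c x x' y
    using ml by (simp_all add: multilinear_2_iff)
  have diag: "f (basis [x, x]) = 0" for x
    using alt by (simp add: alternating_words_def)
  have zero: "f (basis [0, y]) = 0" for y
    using scale[of 0 0 y] by simp
  have neg: "f (basis [- x, y]) = - f (basis [x, y])" for x y
    using scale[of "- 1" x y] by (simp add: fscale_minus_one)
  have diff: "f (basis [x - x', y]) = f (basis [x, y]) - f (basis [x', y])" for x x' y
    using add[of x "- x'" y] by (simp add: neg)
  \<comment> \<open>Comparing coefficients turns \<open>fscale\<close> into multiplication in the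
    field; the instances of \<open>swap\<close> put each product of basis vectors into one fixed
    order so that the terms cancel.\<close>
  have "f (lin_extend L.boundary_word koszul_cycle) = 0"
    by (rule poly_mapping_eqI)
      (simp add: koszul_cycle_def lin_extend_simps flinear_simps[OF f] L.boundary_word_3 lie_bracket_e
        add diff neg zero diag lookup_add lookup_minus algebra_simps
        swap[of "e 4" "e 3"] swap[of "e 6" "e 0"] swap[of "e 7" "e 1"] swap[of "e 8" "e 2"]
        swap[of "e 9" "e 3"] swap[of "e 10" "e 4"] swap[of "e 10" "e 9"] swap[of "e 11" "e 5"])
  then show ?thesis by (simp add: ker)
qed

text \<open>In the order of \<open>koszul_cycle\<close> the words contribute 1, -3, 4, 0, -3, 2, -3,
  0. The total is nonzero exactly when the characteristic is not 2.\<close>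

lemma hyperbolic_form_koszul_cycle:
  "lin_extend (\<lambda>xs. Poly_Mapping.single () (hyperbolic_form (xs ! 0) (lie_bracket (xs ! 1) (xs ! 2))))
    koszul_cycle = Poly_Mapping.single () (- 2)"
  by (rule poly_mapping_eqI)
    (simp add: koszul_cycle_def lin_extend_simps fscale_single lie_bracket_e hyperbolic_form_def e_nth
      lookup_add lookup_minus)

theorem theorem1p8:
  assumes "CHAR('k::field) \<noteq> 2"
  shows "\<exists>bracket :: 'k ^ 12 \<Rightarrow> 'k ^ 12 \<Rightarrow> 'k ^ 12.
    lie_algebra (*s) bracket \<and>
    vec.dim (UNIV :: ('k ^ 12) set) = 12 \<and>
    lie_algebra.nilpotent (*s) bracket 7 \<and>
    (\<exists>h \<in> lie_algebra.homology (*s) bracket 3.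
       lie_algebra.reduced_koszul_map (*s) bracket h \<noteq> lie_algebra.killing_null (*s) bracket)"
proof (intro exI conjI)
  \<comment> \<open>A divisor of the prime 2 is 1 or 2, and a field does not have characteristic 1.
    Characteristic 0 is covered, as 0 does not divide 2.\<close>
  have "\<not> CHAR('k) dvd 2"
    using assms CHAR_not_1[where ?'a = 'k] by (metis One_nat_def prime_nat_iff two_is_prime_nat)
  then have "(2 :: 'k) \<noteq> 0"
    using of_nat_eq_0_iff_char_dvd[of 2, where ?'a = 'k] by simp
  then show "\<exists>h \<in> L.homology 3. L.reduced_koszul_map h \<noteq> (L.killing_null :: (('k ^ 12) list \<Rightarrow>\<^sub>0 'k) set set)"
    by (intro L.reduced_koszul_map_nonzero[where B = hyperbolic_form and w = koszul_cycle]
        koszul_cycle_in_words boundary_koszul_cycle hyperbolic_form_add hyperbolic_form_scale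
        hyperbolic_form_sym hyperbolic_form_invariant)
      (simp add: hyperbolic_form_koszul_cycle poly_mapping_eq_iff fun_eq_iff lookup_single del: One_nat_def)
  show "vec.dim (UNIV :: ('k ^ 12) set) = 12"
    unfolding vec_dim_card by simp
qed (rule lie_algebra_lie_bracket nilpotent_lie_bracket)+

end
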